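(* Let $d\ge 2$, let $(X,\mathcal B,\mu,T)$ be an ergodic dynamical system and let $\Phi:X\to\mathbb R^d$ be a bounded, centered ($\int\Phi\,d\mu=0$) measurable function that satisfies the invariance principle. Let $C$ be a cone in $\mathbb R^d$ with non empty interior and whose complement has non empty interior. Then, for $\mu$-almost every $x$, $$\limsup_{n\to\infty}\tau^\Phi_{n,C}(x)=1\quad\text{and}\quad \liminf_{n\to\infty}\tau^\Phi_{n,C}(x)=0 .$$
   Context: $(X,\mathcal B)$ is a standard Borel space, $\mu$ a probability measure, $T:X\to X$ an invertible measurable map preserving $\mu$. A cone is a (measurable) subset of $\mathbb R^d$ invariant under multiplication by positive reals. Put $\Phi_0=0$, $\Phi_n(x)=\sum_{k=0}^{n-1}\Phi(T^kx)$ for $n\ge1$. For $x\in X$, $n\ge 1$, $s\in[0,1]$, let $W_n^\Phi(x,s)=\Phi_k(x)+(ns-k)\Phi(T^kx)$ if $s\in[\frac kn,\frac{k+1}n[$ (continuous in $s$; $W_n^\Phi(x,1)=\Phi_n(x)$), and $$\tau^\Phi_{n,C}(x)=\int_0^1\mathbf 1_C(W_n^\Phi(x,s))\,ds .$$ $\Phi$ satisfies the invariance principle (Donsker's invariance principle) if the process $W_n^\Phi(x,\cdot)/\sqrt n$, defined on the probability space $(X,\mu)$ with values in the space $\mathcal C_d([0,1])$ of continuous functions $[0,1]\to\mathbb R^d$ with the uniform norm, converges in distribution as $n\to\infty$ to the standard Brownian motion in $\mathbb R^d$ (on $[0,1]$). *)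

theory Defs
  imports "HOL-Probability.Probability"
begin

definition borel_sigma :: "'a topology \<Rightarrow> 'a measure" where
  "borel_sigma X = sigma (topspace X) {U. openin X U}"

definition standard_borel :: "'a measure \<Rightarrow> bool" where
  "standard_borel M \<longleftrightarrow>
     (\<exists>X. completely_metrizable_space X \<and> second_countable X \<and>
          space M = topspace X \<and> sets M = sets (borel_sigma X))"

text \<open>No measurability of the inverse of T is demanded: on a standard Borel space it follows
  from bijectivity and measurability.\<close>

definition ergodic_system :: "'x measure \<Rightarrow> ('x \<Rightarrow> 'x) \<Rightarrow> bool" where
  "ergodic_system M T \<longleftrightarrow>
     standard_borel M \<and> prob_space M \<and>
     T \<in> measurable M M \<and> bij_betw T (space M) (space M) \<and> distr M M T = M \<and>
     (\<forall>A\<in>sets M. T -` A \<inter> space M = A \<longrightarrow> measure M A = 0 \<or> measure M A = 1)"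

text \<open>The library predicate cone also allows the scalar 0; here cones are invariant under
  positive scalars only and need not contain the origin.\<close>

definition positive_cone :: "'v::real_vector set \<Rightarrow> bool" where
  "positive_cone C \<longleftrightarrow> (\<forall>v\<in>C. \<forall>c>0. c *\<^sub>R v \<in> C)"

definition cocycle :: "('x \<Rightarrow> 'x) \<Rightarrow> ('x \<Rightarrow> 'v::real_vector) \<Rightarrow> nat \<Rightarrow> 'x \<Rightarrow> 'v" where
  "cocycle T \<Phi> n x = (\<Sum>k<n. \<Phi> ((T ^^ k) x))"

definition interpolated_path ::
    "('x \<Rightarrow> 'x) \<Rightarrow> ('x \<Rightarrow> 'v::real_vector) \<Rightarrow> nat \<Rightarrow> 'x \<Rightarrow> real \<Rightarrow> 'v" where
  "interpolated_path T \<Phi> n x s =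
     (let k = nat \<lfloor>real n * s\<rfloor>
      in cocycle T \<Phi> k x + (real n * s - real k) *\<^sub>R \<Phi> ((T ^^ k) x))"

lemma interpolated_path_eq:
  assumes "n \<ge> 1" "real k / real n \<le> s" "s < real (k + 1) / real n"
  shows "interpolated_path T \<Phi> n x s =
    cocycle T \<Phi> k x + (real n * s - real k) *\<^sub>R \<Phi> ((T ^^ k) x)"
proof -
  have "\<lfloor>real n * s\<rfloor> = int k"
    using assms by (intro floor_unique) (auto simp: field_simps)
  then show ?thesis by (simp add: interpolated_path_def)
qed

lemma interpolated_path_1: "interpolated_path T \<Phi> n x 1 = cocycle T \<Phi> n x"
  by (simp add: interpolated_path_def)

definition occupation_time ::
    "('x \<Rightarrow> 'x) \<Rightarrow> ('x \<Rightarrow> 'v::real_vector) \<Rightarrow> 'v set \<Rightarrow> nat \<Rightarrow> 'x \<Rightarrow> real" where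
  "occupation_time T \<Phi> C n x =
     (LBINT s:{0..1}. indicator C (interpolated_path T \<Phi> n x s))"

text \<open>The space of continuous paths on the unit interval, with the uniform metric. As a set of
  total functions it consists of functions that are undefined outside the interval.\<close>

definition path_space :: "(real \<Rightarrow> 'v::real_normed_vector) metric" where
  "path_space = cfunspace (top_of_set {0..1}) euclidean_metric"

text \<open>The density is that of the centred Gaussian law with covariance t - s times the
  identity.\<close>

definition standard_brownian_motion ::
    "'w measure \<Rightarrow> (real \<Rightarrow> 'w \<Rightarrow> real ^ 'd) \<Rightarrow> bool" where
  "standard_brownian_motion P B \<longleftrightarrow>
     prob_space P \<and>
     (\<forall>t\<in>{0..1}. B t \<in> borel_measurable P) \<and>
     (\<forall>\<omega>\<in>space P. continuous_on {0..1} (\<lambda>t. B t \<omega>)) \<and>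
     (AE \<omega> in P. B 0 \<omega> = 0) \<and>
     (\<forall>m (t :: nat \<Rightarrow> real). t ` {..m} \<subseteq> {0..1} \<and> mono_on {..m} t \<longrightarrow>
        prob_space.indep_vars P (\<lambda>_. borel) (\<lambda>i \<omega>. B (t (Suc i)) \<omega> - B (t i) \<omega>) {..<m}) \<and>
     (\<forall>s t. 0 \<le> s \<and> s < t \<and> t \<le> 1 \<longrightarrow>
        distributed P lborel (\<lambda>\<omega>. B t \<omega> - B s \<omega>)
          (\<lambda>v. ennreal (\<Prod>i\<in>UNIV. normal_density 0 (sqrt (t - s)) (v $ i))))"

text \<open>The law of standard Brownian motion on the path space, under which the coordinate
  process is a standard Brownian motion.\<close>

definition wiener_measure :: "(real \<Rightarrow> real ^ 'd) measure \<Rightarrow> bool" where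
  "wiener_measure P \<longleftrightarrow>
     space P = mspace path_space \<and>
     sets P = sets (borel_sigma (mtopology_of path_space)) \<and>
     standard_brownian_motion P (\<lambda>t \<omega>. \<omega> t)"

text \<open>Convergence in distribution of random elements of a metric space E, all defined on M,
  to a probability law P on E.\<close>

definition converges_in_distribution ::
    "'x measure \<Rightarrow> 'e metric \<Rightarrow> (nat \<Rightarrow> 'x \<Rightarrow> 'e) \<Rightarrow> 'e measure \<Rightarrow> bool" where
  "converges_in_distribution M E Y P \<longleftrightarrow>
     (\<forall>n. Y n \<in> measurable M (borel_sigma (mtopology_of E))) \<and>
     (\<forall>F. continuous_map (mtopology_of E) euclideanreal F \<and> bounded (F ` mspace E) \<longrightarrow>
        (\<lambda>n. \<integral>x. F (Y n x) \<partial>M) \<longlonglongrightarrow> (\<integral>\<omega>. F \<omega> \<partial>P))"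

definition invariance_principle ::
    "'x measure \<Rightarrow> ('x \<Rightarrow> 'x) \<Rightarrow> ('x \<Rightarrow> real ^ 'd) \<Rightarrow> bool" where
  "invariance_principle M T \<Phi> \<longleftrightarrow>
     (\<exists>P. wiener_measure P \<and>
        converges_in_distribution M path_space
          (\<lambda>n x. \<lambda>s\<in>{0..1}. interpolated_path T \<Phi> n x s /\<^sub>R sqrt (real n)) P)"

end

theory Submission
  imports Defs
begin

text \<open>Let \<open>Y n x\<close> be the rescaled path of \<open>x\<close>. Passing from \<open>x\<close> to \<open>T x\<close> moves \<open>Y n x\<close> by only
  \<open>O(1 / sqrt n)\<close> in the uniform norm, so for a Lipschitz functional \<open>F\<close> the set of all \<open>x\<close> with
  \<open>F (Y n x) \<longlonglongrightarrow> 0\<close> is exactly invariant; if \<open>F\<close> has nonzero Wiener integral, ergodicity forces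
  this set to be null. Take for \<open>F\<close> a functional that is positive precisely on the paths staying,
  during the times from \<open>e\<close> to \<open>1\<close>, in a ball contained in \<open>C\<close>. Since \<open>C\<close> is a cone, almost every
  orbit then spends a proportion at least \<open>1 - e\<close> of its time in \<open>C\<close> for infinitely many \<open>n\<close>. The same
  applies to the complement. Because the ball may be dilated within the cone, \<open>F\<close> has positive Wiener
  integral as soon as the oscillation after time \<open>e\<close> is bounded by some constant with positive
  probability, by independence of increments.\<close>

section \<open>Ergodicity and path functionals that vanish asymptotically\<close>

lemma borel_measurable_borel_sigma:
  fixes F :: "'a \<Rightarrow> 'b::topological_space"
  assumes "continuous_map X euclidean F"
  shows "F \<in> borel_measurable (borel_sigma X)"
proof (rule borel_measurableI)
  fix S :: "'b set" assume "open S"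
  then have "openin X {x \<in> topspace X. F x \<in> S}"
    using assms by (simp add: continuous_map_def)
  moreover have "F -` S \<inter> space (borel_sigma X) = {x \<in> topspace X. F x \<in> S}"
    by (auto simp: borel_sigma_def space_measure_of_conv)
  moreover have "{U. openin X U} \<subseteq> Pow (topspace X)"
    using openin_subset by blast
  ultimately show "F -` S \<inter> space (borel_sigma X) \<in> sets (borel_sigma X)"
    by (simp add: borel_sigma_def)
qed

lemma space_borel_sigma_mtopology [simp]: "space (borel_sigma (mtopology_of E)) = mspace E"
  by (simp add: borel_sigma_def space_measure_of_conv)

text \<open>On a convergence set of full measure, dominated convergence would give the limit 0 for
  the integrals of \<open>F (Y n x)\<close>, while convergence in distribution gives the nonzero
  integral under \<open>P\<close>. Ergodicity leaves only measure 0. The Lipschitz bound makes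
  \<open>F\<close> respond uniformly to \<open>inv\<close>, although the points \<open>Y n x\<close>
  vary with \<open>n\<close> and need not converge.\<close>

lemma ergodic_not_tendsto_zero:
  fixes F :: "'e \<Rightarrow> real"
  assumes erg: "ergodic_system M T"
    and conv: "converges_in_distribution M E Y P"
    and F: "Lipschitz_continuous_map E euclidean_metric F"
    and bdd: "bounded (F ` mspace E)"
    and inv: "\<And>x. x \<in> space M \<Longrightarrow> (\<lambda>n. mdist E (Y n (T x)) (Y n x)) \<longlonglongrightarrow> 0"
    and pos: "(\<integral>\<omega>. F \<omega> \<partial>P) \<noteq> 0"
  shows "AE x in M. \<not> (\<lambda>n. F (Y n x)) \<longlonglongrightarrow> 0"
proof -
  interpret prob_space M using erg by (simp add: ergodic_system_def)
  have T: "T \<in> measurable M M" "bij_betw T (space M) (space M)"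
    using erg by (auto simp: ergodic_system_def)
  have Fc: "continuous_map (mtopology_of E) euclideanreal F"
    using Lipschitz_continuous_imp_continuous_map[OF F] by simp
  have Ymeas: "Y n \<in> measurable M (borel_sigma (mtopology_of E))" for n
    using conv by (simp add: converges_in_distribution_def)
  have FYm [measurable]: "(\<lambda>x. F (Y n x)) \<in> borel_measurable M" for n
    using Ymeas borel_measurable_borel_sigma[OF Fc] by (rule measurable_compose)
  have Ysp: "Y n x \<in> mspace E" if "x \<in> space M" for n x
    using measurable_space[OF Ymeas that] by simp
  define A where "A = {x \<in> space M. (\<lambda>n. F (Y n x)) \<longlonglongrightarrow> 0}"
  have A: "A \<in> sets M" unfolding A_def by measurable
  obtain L where L: "\<And>x y. x \<in> mspace E \<Longrightarrow> y \<in> mspace E \<Longrightarrow> \<bar>F x - F y\<bar> \<le> L * mdist E x y"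
    using F by (auto simp: Lipschitz_continuous_map_def dist_real_def)
  have diff: "(\<lambda>n. F (Y n (T x)) - F (Y n x)) \<longlonglongrightarrow> 0" if x: "x \<in> space M" for x
  proof (rule Lim_null_comparison)
    have "T x \<in> space M" using x T(1) by (auto dest: measurable_space)
    then show "\<forall>\<^sub>F n in sequentially.
        norm (F (Y n (T x)) - F (Y n x)) \<le> L * mdist E (Y n (T x)) (Y n x)"
      using L Ysp x by simp
    show "(\<lambda>n. L * mdist E (Y n (T x)) (Y n x)) \<longlonglongrightarrow> 0"
      by (rule tendsto_mult_right_zero[OF inv[OF x]])
  qed
  \<comment> \<open>Two sequences whose difference tends to 0 tend to 0 together, so the invariance
    is an equality of sets, as \<open>ergodic_system\<close> demands.\<close>
  have "T -` A \<inter> space M = A"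
  proof -
    have "(\<lambda>n. F (Y n (T x))) \<longlonglongrightarrow> 0 \<longleftrightarrow> (\<lambda>n. F (Y n x)) \<longlonglongrightarrow> 0" if x: "x \<in> space M" for x
      using Lim_transform[OF _ diff[OF x]] Lim_transform2[OF _ diff[OF x]] by blast
    then show ?thesis
      using T(1) by (auto simp: A_def dest: measurable_space)
  qed
  then have "prob A = 0 \<or> prob A = 1"
    using erg A by (auto simp: ergodic_system_def)
  moreover have "prob A \<noteq> 1"
  proof
    assume "prob A = 1"
    then have "AE x in M. x \<in> A" by (simp add: A prob_eq_1)
    then have lim: "AE x in M. (\<lambda>n. F (Y n x)) \<longlonglongrightarrow> 0" by eventually_elim (simp add: A_def)
    obtain K where K: "\<And>x. x \<in> mspace E \<Longrightarrow> norm (F x) \<le> K"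
      using bdd by (auto simp: bounded_iff)
    have "(\<lambda>n. \<integral>x. F (Y n x) \<partial>M) \<longlonglongrightarrow> (\<integral>x. 0 \<partial>M)"
      by (rule integral_dominated_convergence[where w = "\<lambda>_. K"])
        (use lim K Ysp in \<open>auto intro!: AE_I2\<close>)
    moreover have "(\<lambda>n. \<integral>x. F (Y n x) \<partial>M) \<longlonglongrightarrow> (\<integral>\<omega>. F \<omega> \<partial>P)"
      using conv Fc bdd by (auto simp: converges_in_distribution_def)
    ultimately show False using pos LIMSEQ_unique by fastforce
  qed
  ultimately have "prob A = 0" by blast
  then have "AE x in M. x \<notin> A" using A by (simp add: prob_eq_0)
  then show ?thesis by (auto simp: A_def)
qed

section \<open>A Lipschitz functional detecting tubes in path space\<close>

lemma path_space_continuous_on: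
  fixes \<omega> :: "real \<Rightarrow> 'v::real_normed_vector"
  assumes "\<omega> \<in> mspace path_space"
  shows "continuous_on {0..1} \<omega>"
  using assms by (simp add: path_space_def)

lemma dist_path_space_le:
  fixes \<omega> \<omega>' :: "real \<Rightarrow> 'v::real_normed_vector"
  assumes "\<omega> \<in> mspace path_space" "\<omega>' \<in> mspace path_space" "s \<in> {0..1}"
  shows "dist (\<omega> s) (\<omega>' s) \<le> mdist path_space \<omega> \<omega>'"
  using mdist_cfunspace_imp_mdist_le[of \<omega> "top_of_set {0..1}" euclidean_metric \<omega>'
      "mdist path_space \<omega> \<omega>'" s] assms
  unfolding path_space_def by simp

text \<open>A Lipschitz substitute for the indicator of the paths that remain within
  \<open>r\<close> of the fixed point \<open>v\<close> from time \<open>e\<close> to time 1: for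
  \<open>r > 0\<close> it is positive exactly when the supremum is below \<open>r\<close>.\<close>

definition tube_functional :: "real \<Rightarrow> 'v \<Rightarrow> real \<Rightarrow> (real \<Rightarrow> 'v::real_normed_vector) \<Rightarrow> real" where
  "tube_functional e v r \<omega> = max 0 (1 - (SUP s\<in>{e..1}. dist (\<omega> s) v) / r)"

lemma bdd_above_dist_path:
  fixes \<omega> :: "real \<Rightarrow> 'v::real_normed_vector"
  assumes "\<omega> \<in> mspace path_space" "0 \<le> e"
  shows "bdd_above ((\<lambda>s. dist (\<omega> s) v) ` {e..1})"
proof -
  have "continuous_on {e..1} \<omega>"
    using path_space_continuous_on[OF assms(1)] by (rule continuous_on_subset) (use assms in auto)
  then have "continuous_on {e..1} (\<lambda>s. dist (\<omega> s) v)" by (intro continuous_intros)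
  then have "compact ((\<lambda>s. dist (\<omega> s) v) ` {e..1})"
    using compact_continuous_image compact_Icc by blast
  then show ?thesis by (simp add: compact_imp_bounded bounded_imp_bdd_above)
qed

text \<open>The supremum of the distances to \<open>v\<close> is 1-Lipschitz for the uniform metric;
  dividing by \<open>r\<close> gives the constant \<open>1 / r\<close>, and truncation at 0 does not
  increase it.\<close>

lemma Lipschitz_tube_functional:
  fixes v :: "'v::real_normed_vector"
  assumes e: "0 \<le> e" "e \<le> 1" and r: "r > 0"
  shows "Lipschitz_continuous_map path_space euclidean_metric (tube_functional e v r)"
proof -
  have *: "(SUP s\<in>{e..1}. dist (\<omega> s) v) \<le> (SUP s\<in>{e..1}. dist (\<omega>' s) v) + mdist path_space \<omega> \<omega>'"
    if \<omega>: "\<omega> \<in> mspace path_space" "\<omega>' \<in> mspace path_space" for \<omega> \<omega>'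
  proof (rule cSUP_least)
    fix s assume s: "s \<in> {e..1}"
    have "dist (\<omega> s) v \<le> dist (\<omega>' s) v + dist (\<omega> s) (\<omega>' s)"
      by (metis add.commute dist_triangle)
    also have "dist (\<omega> s) (\<omega>' s) \<le> mdist path_space \<omega> \<omega>'"
      using dist_path_space_le[OF \<omega>, of s] s e by auto
    also have "dist (\<omega>' s) v \<le> (SUP s\<in>{e..1}. dist (\<omega>' s) v)"
      by (rule cSUP_upper[OF s bdd_above_dist_path[OF \<omega>(2) e(1)]])
    finally show "dist (\<omega> s) v \<le> (SUP s\<in>{e..1}. dist (\<omega>' s) v) + mdist path_space \<omega> \<omega>'"
      by simp
  qed (use e in auto)
  have "dist (tube_functional e v r \<omega>) (tube_functional e v r \<omega>') \<le> (1 / r) * mdist path_space \<omega> \<omega>'"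
    if \<omega>: "\<omega> \<in> mspace path_space" "\<omega>' \<in> mspace path_space" for \<omega> \<omega>'
  proof -
    let ?S = "\<lambda>\<omega>. (SUP s\<in>{e..1}. dist (\<omega> s) v)"
    have "\<bar>?S \<omega> - ?S \<omega>'\<bar> \<le> mdist path_space \<omega> \<omega>'"
      using *[OF \<omega>] *[OF \<omega>(2,1)] by (simp add: mdist_commute)
    then have "\<bar>?S \<omega> / r - ?S \<omega>' / r\<bar> \<le> (1 / r) * mdist path_space \<omega> \<omega>'"
      using r by (simp add: diff_divide_distrib[symmetric] divide_right_mono)
    then show ?thesis
      unfolding tube_functional_def dist_real_def by linarith
  qed
  then show ?thesis
    unfolding Lipschitz_continuous_map_def mdist_euclidean_metric
    by (intro conjI exI[of _ "1 / r"]) auto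
qed

lemma bounded_tube_functional:
  fixes v :: "'v::real_normed_vector"
  assumes "0 \<le> e" "e \<le> 1" "r > 0"
  shows "bounded (tube_functional e v r ` mspace path_space)"
proof -
  have "0 \<le> (SUP s\<in>{e..1}. dist (\<omega> s) v)" if "\<omega> \<in> mspace path_space" for \<omega>
    using cSUP_upper[OF _ bdd_above_dist_path[OF that assms(1)], of e v] assms
    by (meson atLeastAtMost_iff order.refl order_trans zero_le_dist)
  then have "tube_functional e v r \<omega> \<in> {0..1}" if "\<omega> \<in> mspace path_space" for \<omega>
    using that assms by (auto simp: tube_functional_def)
  then show ?thesis
    by (intro bounded_subset[OF bounded_closed_interval[of 0 1]]) auto
qed

lemma tube_functional_posD:
  fixes v :: "'v::real_normed_vector"
  assumes "\<omega> \<in> mspace path_space" "0 \<le> e" "r > 0" "tube_functional e v r \<omega> > 0" "s \<in> {e..1}"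
  shows "dist (\<omega> s) v < r"
proof -
  have "dist (\<omega> s) v \<le> (SUP s\<in>{e..1}. dist (\<omega> s) v)"
    by (rule cSUP_upper[OF assms(5) bdd_above_dist_path[OF assms(1,2)]])
  also have "\<dots> < r"
    using assms(3,4) by (simp add: tube_functional_def less_max_iff_disj field_simps)
  finally show ?thesis .
qed

lemma tube_functional_ge:
  fixes v :: "'v::real_normed_vector"
  assumes "e \<le> 1" "r > 0" "\<And>s. s \<in> {e..1} \<Longrightarrow> dist (\<omega> s) v \<le> K"
  shows "tube_functional e v r \<omega> \<ge> 1 - K / r"
proof -
  have "(SUP s\<in>{e..1}. dist (\<omega> s) v) \<le> K" by (rule cSUP_least) (use assms in auto)
  then have "(SUP s\<in>{e..1}. dist (\<omega> s) v) / r \<le> K / r" using assms by (simp add: divide_right_mono)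
  then show ?thesis unfolding tube_functional_def by linarith
qed

section \<open>The effect of \<open>T\<close> on interpolated paths\<close>

lemma cocycle_shift: "cocycle T \<Phi> k (T x) = cocycle T \<Phi> k x + \<Phi> ((T ^^ k) x) - \<Phi> x"
proof (induction k)
  case (Suc k)
  then show ?case by (simp add: cocycle_def funpow_swap1)
qed (simp add: cocycle_def)

text \<open>Both sums share all but their end terms, and the interpolation adds at most one full
  difference of two values of \<Phi>. Four values of norm at most \<open>K\<close> remain, whatever
  \<open>n\<close> and \<open>s\<close> are.\<close>

lemma interpolated_path_shift:
  fixes \<Phi> :: "'x \<Rightarrow> 'v::real_normed_vector"
  assumes T: "\<And>x. x \<in> S \<Longrightarrow> T x \<in> S" and K: "\<And>x. x \<in> S \<Longrightarrow> norm (\<Phi> x) \<le> K"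
    and x: "x \<in> S" and s: "0 \<le> s"
  shows "norm (interpolated_path T \<Phi> n (T x) s - interpolated_path T \<Phi> n x s) \<le> 4 * K"
proof -
  have TkS: "(T ^^ k) x \<in> S" for k by (induction k) (auto simp: T x)
  define k where "k = nat \<lfloor>real n * s\<rfloor>"
  have c: "0 \<le> real n * s - real k" "real n * s - real k \<le> 1"
    using s by (simp_all add: k_def) linarith
  have "interpolated_path T \<Phi> n (T x) s - interpolated_path T \<Phi> n x s =
      \<Phi> ((T ^^ k) x) - \<Phi> x + (real n * s - real k) *\<^sub>R (\<Phi> ((T ^^ Suc k) x) - \<Phi> ((T ^^ k) x))"
    unfolding interpolated_path_def k_def[symmetric] Let_def
    by (simp add: cocycle_shift funpow_swap1 algebra_simps)
  also have "norm \<dots> \<le> (norm (\<Phi> ((T ^^ k) x)) + norm (\<Phi> x)) +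
      1 * (norm (\<Phi> ((T ^^ Suc k) x)) + norm (\<Phi> ((T ^^ k) x)))"
  proof (intro norm_triangle_mono norm_triangle_ineq4)
    have "(real n * s - real k) * norm (\<Phi> ((T ^^ Suc k) x) - \<Phi> ((T ^^ k) x)) \<le>
        1 * (norm (\<Phi> ((T ^^ Suc k) x)) + norm (\<Phi> ((T ^^ k) x)))"
      by (rule mult_mono) (use c norm_triangle_ineq4 in \<open>auto simp del: funpow.simps\<close>)
    then show "norm ((real n * s - real k) *\<^sub>R (\<Phi> ((T ^^ Suc k) x) - \<Phi> ((T ^^ k) x))) \<le>
        1 * (norm (\<Phi> ((T ^^ Suc k) x)) + norm (\<Phi> ((T ^^ k) x)))"
      using c by (simp del: funpow.simps)
  qed
  also have "\<dots> \<le> 4 * K"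
    using K[OF x] K[OF TkS[of k]] K[OF TkS[of "Suc k"]] by (simp del: funpow.simps)
  finally show ?thesis .
qed

section \<open>Positivity estimates for Brownian motion\<close>

text \<open>The definition of Brownian motion gives independence for finitely many increments only,
  whereas \<open>R\<close> involves uncountably many times. By continuity of paths \<open>R\<close>
  is the decreasing limit of events \<open>E m\<close> on dyadic grids; each of these is independent
  of \<open>A\<close>, and the product formula passes to the limit.\<close>

lemma brownian_increment_indep_oscillation:
  fixes B :: "real \<Rightarrow> 'w \<Rightarrow> real ^ 'd" and L :: real
  assumes bm: "standard_brownian_motion P B" and e: "0 < e" "e < 1"
    and U: "U \<in> sets borel"
  defines "R \<equiv> {\<omega> \<in> space P. \<forall>s\<in>{e..1}. dist (B s \<omega>) (B e \<omega>) \<le> L}"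
    and "A \<equiv> {\<omega> \<in> space P. B e \<omega> - B 0 \<omega> \<in> U}"
  shows "R \<in> sets P" and "measure P (A \<inter> R) = measure P A * measure P R"
proof -
  interpret prob_space P using bm by (simp add: standard_brownian_motion_def)
  have Bm: "B t \<in> borel_measurable P" if "t \<in> {0..1}" for t
    using bm that by (simp add: standard_brownian_motion_def)
  have [measurable]: "B e \<in> borel_measurable P" "B 0 \<in> borel_measurable P"
    using Bm e by auto
  have Bc: "continuous_on {0..1} (\<lambda>t. B t \<omega>)" if "\<omega> \<in> space P" for \<omega>
    using bm that by (simp add: standard_brownian_motion_def)
  have A: "A \<in> sets P" unfolding A_def using U by measurable
  \<comment> \<open>The points \<open>g m i\<close> with \<open>i \<le> 2 ^ m\<close> cut the
    interval from \<open>e\<close> to 1 into \<open>2 ^ m\<close> equal pieces. Halving the pieces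
    keeps the old points, which makes \<open>E\<close> decreasing.\<close>
  define g where "g m i = e + (1 - e) * (real i / 2 ^ m)" for m i
  define E where "E m = {\<omega> \<in> space P. \<forall>i\<le>2 ^ m. dist (B (g m i) \<omega>) (B e \<omega>) \<le> L}" for m :: nat
  have g01: "g m i \<in> {e..1}" if "i \<le> 2 ^ m" for m i
  proof -
    have "real i \<le> real (2 ^ m)" using that by (simp only: of_nat_le_iff)
    then have "real i / 2 ^ m \<le> 1" by simp
    then have "(1 - e) * (real i / 2 ^ m) \<le> (1 - e) * 1" using e by (intro mult_left_mono) auto
    then show ?thesis using e by (simp add: g_def)
  qed
  have gB [measurable]: "B (g m i) \<in> borel_measurable P" if "i \<le> 2 ^ m" for m i
    using Bm g01[OF that] e by auto
  have Em: "E m \<in> sets P" for m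
  proof -
    have "E m = (\<Inter>i\<in>{..2^m}. {\<omega> \<in> space P. dist (B (g m i) \<omega>) (B e \<omega>) \<le> L})"
      by (auto simp: E_def)
    also have "\<dots> \<in> sets P" by (intro sets.finite_INT) auto
    finally show ?thesis .
  qed
  have dec: "decseq E"
  proof (rule decseq_SucI, rule subsetI)
    fix m \<omega> assume \<omega>: "\<omega> \<in> E (Suc m)"
    have "dist (B (g m i) \<omega>) (B e \<omega>) \<le> L" if "i \<le> 2 ^ m" for i
    proof -
      have "g m i = g (Suc m) (2 * i)" by (simp add: g_def)
      then show ?thesis using \<omega> that by (auto simp: E_def)
    qed
    then show "\<omega> \<in> E m" using \<omega> by (auto simp: E_def)
  qed
  have R: "(\<Inter>m. E m) = R"
  proof (intro equalityI subsetI)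
    fix \<omega> assume "\<omega> \<in> (\<Inter>m. E m)"
    then have \<omega>: "\<omega> \<in> space P"
      and le: "\<And>m i. i \<le> 2 ^ m \<Longrightarrow> dist (B (g m i) \<omega>) (B e \<omega>) \<le> L"
      by (auto simp: E_def)
    have "dist (B s \<omega>) (B e \<omega>) \<le> L" if s: "s \<in> {e..1}" for s
    proof -
      define u where "u = (s - e) / (1 - e)"
      have u: "0 \<le> u" "u \<le> 1" "s = e + (1 - e) * u" using s e by (auto simp: u_def)
      \<comment> \<open>Rounding \<open>u\<close> down to the grid yields grid points tending to
        \<open>s\<close>, and continuity carries the closed condition over to
        \<open>s\<close>.\<close>
      define i where "i m = nat \<lfloor>u * 2 ^ m\<rfloor>" for m :: nat
      have i_eq: "real (i m) = of_int \<lfloor>u * 2 ^ m\<rfloor>" for m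
        using u by (simp add: i_def)
      have i_le: "i m \<le> 2 ^ m" for m
      proof -
        have "real (i m) \<le> u * 2 ^ m" unfolding i_eq by (rule of_int_floor_le)
        also have "\<dots> \<le> real (2 ^ m)" using u by (simp add: mult_left_le_one_le)
        finally show ?thesis by (simp only: of_nat_le_iff)
      qed
      have "(\<lambda>m. real (i m) / 2 ^ m) \<longlonglongrightarrow> u"
      proof (rule tendsto_sandwich)
        show "\<forall>\<^sub>F m in sequentially. u - (1/2) ^ m \<le> real (i m) / 2 ^ m"
        proof (intro always_eventually allI)
          fix m
          have "u * 2 ^ m - 1 \<le> real (i m)" unfolding i_eq by linarith
          then have "(u * 2 ^ m - 1) / 2 ^ m \<le> real (i m) / 2 ^ m" by (simp add: divide_right_mono)
          then show "u - (1/2) ^ m \<le> real (i m) / 2 ^ m" by (simp add: diff_divide_distrib power_divide)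
        qed
        show "\<forall>\<^sub>F m in sequentially. real (i m) / 2 ^ m \<le> u"
          unfolding i_eq by (simp add: field_simps)
        have "(\<lambda>m. u - (1/2) ^ m) \<longlonglongrightarrow> u - 0" by (intro tendsto_intros) auto
        then show "(\<lambda>m. u - (1/2) ^ m) \<longlonglongrightarrow> u" by simp
      qed auto
      then have lim: "(\<lambda>m. g m (i m)) \<longlonglongrightarrow> s"
        unfolding g_def u(3) by (intro tendsto_intros)
      have "(\<lambda>m. B (g m (i m)) \<omega>) \<longlonglongrightarrow> B s \<omega>"
        by (rule continuous_on_tendsto_compose[OF Bc[OF \<omega>] lim])
          (use s e g01[OF i_le] in \<open>auto intro!: always_eventually order_trans[OF less_imp_le[OF e(1)]]\<close>)
      then have "(\<lambda>m. dist (B (g m (i m)) \<omega>) (B e \<omega>)) \<longlonglongrightarrow> dist (B s \<omega>) (B e \<omega>)"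
        by (intro tendsto_intros)
      then show ?thesis
        by (rule LIMSEQ_le_const2) (use le[OF i_le] in auto)
    qed
    then show "\<omega> \<in> R" using \<omega> by (auto simp: R_def)
  next
    fix \<omega> assume "\<omega> \<in> R"
    then show "\<omega> \<in> (\<Inter>m. E m)" using g01 by (auto simp: R_def E_def simp del: atLeastAtMost_iff)
  qed
  show "R \<in> sets P" unfolding R[symmetric] using Em by (intro sets.countable_INT) auto
  have ind: "prob (A \<inter> E m) = prob A * prob (E m)" for m
  proof -
    define N :: nat where "N = 2 ^ m"
    \<comment> \<open>The grid with time 0 put in front: \<open>X 0\<close> is the increment from 0
      to \<open>e\<close>, and \<open>X j\<close> for \<open>j \<ge> 1\<close> is the increment from
      \<open>g m (j - 1)\<close> to \<open>g m j\<close>.\<close>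
    define t where "t i = (case i of 0 \<Rightarrow> 0 | Suc j \<Rightarrow> g m j)" for i
    define X where "X i \<omega> = B (t (Suc i)) \<omega> - B (t i) \<omega>" for i \<omega>
    have gmono: "g m i \<le> g m j" if "i \<le> j" for i j
      using that e by (auto simp: g_def intro!: mult_left_mono divide_right_mono)
    have t01: "t ` {..Suc N} \<subseteq> {0..1}"
      using g01[of _ m] e by (fastforce simp: t_def N_def split: nat.splits)
    have tmono: "mono_on {..Suc N} t"
    proof (rule mono_onI)
      fix i j assume ij: "i \<in> {..Suc N}" "j \<in> {..Suc N}" "i \<le> j"
      have "0 \<le> t j" using t01 ij by auto
      then show "t i \<le> t j" using ij gmono by (auto simp: t_def split: nat.splits)
    qed
    have "indep_vars (\<lambda>_. borel) X {..<Suc N}"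
      using bm t01 tmono unfolding standard_brownian_motion_def X_def by blast
    \<comment> \<open>Disjoint blocks of independent increments are independent; the first block
      determines \<open>A\<close>, the second \<open>E m\<close>.\<close>
    then have iv: "indep_var
        (PiM {0} (\<lambda>_. borel)) (\<lambda>\<omega>. restrict (\<lambda>i. X i \<omega>) {0})
        (PiM {1..<Suc N} (\<lambda>_. borel)) (\<lambda>\<omega>. restrict (\<lambda>i. X i \<omega>) {1..<Suc N})"
      by (rule indep_var_restrict) auto
    define Xa where "Xa = {f \<in> space (PiM {0::nat} (\<lambda>_. borel :: (real^'d) measure)). f 0 \<in> U}"
    \<comment> \<open>The partial sums recover the displacement from time \<open>e\<close>. The
      index \<open>i = 0\<close> gives the empty sum, matching the distance of \<open>B e\<close> to
      itself in \<open>E m\<close>.\<close>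
    define Xb where "Xb = {f \<in> space (PiM {1..<Suc N} (\<lambda>_. borel :: (real^'d) measure)).
        \<forall>i\<in>{..N}. norm (\<Sum>j\<in>{1..<Suc i}. f j) \<le> L}"
    have Xa: "Xa \<in> sets (PiM {0} (\<lambda>_. borel))" unfolding Xa_def using U by measurable
    have Xb: "Xb \<in> sets (PiM {1..<Suc N} (\<lambda>_. borel))"
    proof -
      have [measurable]: "(\<lambda>f. \<Sum>j\<in>{1..<Suc i}. f j) \<in>
          borel_measurable (PiM {1..<Suc N} (\<lambda>_. borel :: (real^'d) measure))" if "i \<in> {..N}" for i
        using that by (intro borel_measurable_sum measurable_component_singleton) auto
      show ?thesis unfolding Xb_def by measurable
    qed
    have a: "(\<lambda>\<omega>. restrict (\<lambda>i. X i \<omega>) {0}) -` Xa \<inter> space P = A"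
      by (auto simp: Xa_def A_def X_def t_def g_def space_PiM)
    have sumX: "(\<Sum>j\<in>{1..<Suc i}. restrict (\<lambda>i. X i \<omega>) {1..<Suc N} j) = B (g m i) \<omega> - B e \<omega>"
      if "i \<le> N" for i \<omega>
    proof -
      have "(\<Sum>j\<in>{1..<Suc i}. restrict (\<lambda>i. X i \<omega>) {1..<Suc N} j) = (\<Sum>j\<in>{1..<Suc i}. X j \<omega>)"
        by (rule sum.cong) (use that in auto)
      also have "\<dots> = (\<Sum>j<i. B (g m (Suc j)) \<omega> - B (g m j) \<omega>)"
        unfolding One_nat_def sum.shift_bounds_Suc_ivl by (simp add: X_def t_def atLeast0LessThan)
      also have "\<dots> = B (g m i) \<omega> - B (g m 0) \<omega>" by (rule sum_lessThan_telescope)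
      finally show ?thesis by (simp add: g_def)
    qed
    have "restrict (\<lambda>i. X i \<omega>) {1..<Suc N} \<in> Xb \<longleftrightarrow>
        (\<forall>i\<in>{..N}. dist (B (g m i) \<omega>) (B e \<omega>) \<le> L)" for \<omega>
    proof -
      have "restrict (\<lambda>i. X i \<omega>) {1..<Suc N} \<in> space (PiM {1..<Suc N} (\<lambda>_. borel))"
        by (simp add: space_PiM)
      moreover have "(\<forall>i\<in>{..N}.
          norm (\<Sum>j\<in>{1..<Suc i}. restrict (\<lambda>i. X i \<omega>) {1..<Suc N} j) \<le> L) \<longleftrightarrow>
        (\<forall>i\<in>{..N}. dist (B (g m i) \<omega>) (B e \<omega>) \<le> L)"
        by (rule ball_cong[OF refl]) (simp only: sumX atMost_iff dist_norm)
      ultimately show ?thesis unfolding Xb_def by blast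
    qed
    then have b: "(\<lambda>\<omega>. restrict (\<lambda>i. X i \<omega>) {1..<Suc N}) -` Xb \<inter> space P = E m"
      by (auto simp: E_def N_def)
    have "prob ((\<lambda>\<omega>. (restrict (\<lambda>i. X i \<omega>) {0}, restrict (\<lambda>i. X i \<omega>) {1..<Suc N})) -` (Xa \<times> Xb)
        \<inter> space P) = prob A * prob (E m)"
      using indep_varD[OF iv Xa Xb] unfolding a b .
    moreover have "(\<lambda>\<omega>. (restrict (\<lambda>i. X i \<omega>) {0}, restrict (\<lambda>i. X i \<omega>) {1..<Suc N})) -` (Xa \<times> Xb)
        \<inter> space P = A \<inter> E m"
      unfolding a[symmetric] b[symmetric] by auto
    ultimately show ?thesis by simp
  qed
  \<comment> \<open>Continuity of the measure from above, applied to both sides of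
    \<open>ind\<close>.\<close>
  have "(\<lambda>m. prob (A \<inter> E m)) \<longlonglongrightarrow> prob (\<Inter>m. A \<inter> E m)"
    by (rule finite_Lim_measure_decseq) (use A Em dec in \<open>auto simp: decseq_def\<close>)
  moreover have "(\<lambda>m. prob (E m)) \<longlonglongrightarrow> prob (\<Inter>m. E m)"
    by (rule finite_Lim_measure_decseq) (use Em dec in auto)
  then have "(\<lambda>m. prob A * prob (E m)) \<longlonglongrightarrow> prob A * prob (\<Inter>m. E m)"
    by (intro tendsto_intros)
  moreover have "(\<Inter>m. A \<inter> E m) = A \<inter> R" using R by auto
  ultimately show "prob (A \<inter> R) = prob A * prob R"
    unfolding ind R by (simp add: LIMSEQ_unique)
qed

text \<open>The Gaussian density vanishes nowhere, so probability 0 would make \<open>U\<close> a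
  Lebesgue null set, which a nonempty open set is not.\<close>

lemma brownian_increment_ball_pos:
  fixes B :: "real \<Rightarrow> 'w \<Rightarrow> real ^ 'd"
  assumes bm: "standard_brownian_motion P B" and e: "0 < e" "e \<le> 1"
    and U: "open U" "U \<noteq> {}"
  shows "measure P {\<omega> \<in> space P. B e \<omega> - B 0 \<omega> \<in> U} > 0"
proof -
  interpret prob_space P using bm by (simp add: standard_brownian_motion_def)
  \<comment> \<open>The form \<open>e - 0\<close> matches the instance of the definition with start
    time 0 literally.\<close>
  let ?f = "\<lambda>v :: real ^ 'd. ennreal (\<Prod>i\<in>UNIV. normal_density 0 (sqrt (e - 0)) (v $ i))"
  have D: "distributed P lborel (\<lambda>\<omega>. B e \<omega> - B 0 \<omega>) ?f"
    using bm e unfolding standard_brownian_motion_def by blast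
  have fpos: "?f v > 0" for v
    using e by (auto intro!: prod_pos normal_density_pos)
  have Ub: "U \<in> sets lborel" using U by simp
  have fm: "?f \<in> borel_measurable lborel" by (rule distributed_borel_measurable[OF D])
  have "emeasure P {\<omega> \<in> space P. B e \<omega> - B 0 \<omega> \<in> U} \<noteq> 0"
  proof
    assume 0: "emeasure P {\<omega> \<in> space P. B e \<omega> - B 0 \<omega> \<in> U} = 0"
    have "emeasure P ((\<lambda>\<omega>. B e \<omega> - B 0 \<omega>) -` U \<inter> space P) = (\<integral>\<^sup>+v. ?f v * indicator U v \<partial>lborel)"
      by (rule distributed_emeasure[OF D Ub])
    then have "(\<integral>\<^sup>+v. ?f v * indicator U v \<partial>lborel) = 0"
      using 0 by (simp add: vimage_def Int_def conj_commute)
    then have "AE v in lborel. ?f v * indicator U v = 0"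
      using fm Ub by (subst (asm) nn_integral_0_iff_AE) auto
    then have "AE v in lborel. v \<notin> U"
    proof eventually_elim
      case (elim v)
      show ?case
      proof
        assume "v \<in> U"
        then have "?f v = 0" using elim by (simp only: indicator_simps mult_1_right)
        then show False using fpos[of v] by (metis less_irrefl)
      qed
    qed
    then have "emeasure lborel U = 0"
      using AE_iff_measurable[OF Ub, of "\<lambda>v. v \<notin> U"] by auto
    \<comment> \<open>Negligibility refers to the completed measure, hence the passage from
      \<open>lborel\<close> to \<open>lebesgue\<close>.\<close>
    then have "U \<in> null_sets lebesgue" using Ub by (intro null_sets_completionI) auto
    then have "negligible U" by (simp add: negligible_iff_null_sets)
    then show False using open_not_negligible U by blast
  qed
  then show ?thesis by (simp add: measure_nonneg less_le emeasure_eq_measure)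
qed

text \<open>The dilation \<open>c\<close> is chosen last: first a bound on the oscillation after
  \<open>e\<close> that holds with positive probability, then a ball so large that such a path, once
  near the centre at time \<open>e\<close>, stays well inside. Independence gives both events
  together positive probability.\<close>

lemma wiener_tube_functional_pos:
  fixes P :: "(real \<Rightarrow> real ^ 'd) measure" and w :: "real ^ 'd"
  assumes W: "wiener_measure P" and e: "0 < e" "e < 1" and \<rho>: "\<rho> > 0"
  obtains c where "c > 0" "(\<integral>\<omega>. tube_functional e (c *\<^sub>R w) (c * \<rho>) \<omega> \<partial>P) \<noteq> 0"
proof -
  have bm: "standard_brownian_motion P (\<lambda>t \<omega>. \<omega> t)"
    and sp: "space P = mspace path_space"
    and se: "sets P = sets (borel_sigma (mtopology_of path_space))"
    using W by (auto simp: wiener_measure_def)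
  interpret prob_space P using bm by (simp add: standard_brownian_motion_def)
  define R where "R L = {\<omega> \<in> space P. \<forall>s\<in>{e..1}. dist (\<omega> s) (\<omega> e) \<le> L}" for L
  have Rm: "R L \<in> sets P" for L
    unfolding R_def
    by (rule brownian_increment_indep_oscillation(1)[OF bm e, of UNIV]) auto
  \<comment> \<open>Continuous paths are bounded on a compact interval, so the sets
    \<open>R n\<close> exhaust the space and cannot all be null.\<close>
  obtain n where n: "prob (R (real n)) \<noteq> 0"
  proof (rule ccontr)
    assume "\<not> thesis"
    then have "prob (R (real n)) = 0" for n using that by blast
    then have "AE \<omega> in P. \<forall>n. \<omega> \<notin> R (real n)"
      using Rm by (simp add: AE_all_countable prob_eq_0)
    then have "AE \<omega> in P. \<omega> \<notin> space P"
    proof eventually_elim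
      case (elim \<omega>)
      show ?case
      proof
        assume \<omega>: "\<omega> \<in> space P"
        have "bdd_above ((\<lambda>s. dist (\<omega> s) (\<omega> e)) ` {e..1})"
          by (rule bdd_above_dist_path) (use \<omega> e sp in auto)
        then obtain K where K: "\<And>s. s \<in> {e..1} \<Longrightarrow> dist (\<omega> s) (\<omega> e) \<le> K"
          by (meson bdd_above.unfold image_eqI)
        obtain n where "K \<le> real n" using real_arch_simple by blast
        then have "\<omega> \<in> R (real n)" using order_trans[OF K] \<omega> by (simp add: R_def)
        then show False using elim by blast
      qed
    qed
    with AE_space[of P] have "AE \<omega> in P. False" by eventually_elim blast
    then show False by simp
  qed
  \<comment> \<open>On \<open>A\<close> and \<open>R n\<close> the path stays within
    \<open>n + 1\<close> of the centre. The factor 2 makes this half the radius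
    \<open>c * \<rho>\<close>, so the functional is at least 1/2 there.\<close>
  define c where "c = 2 * (real n + 1) / \<rho>"
  have c: "c > 0" "c * \<rho> = 2 * (real n + 1)" using \<rho> by (auto simp: c_def)
  define A where "A = {\<omega> \<in> space P. \<omega> e - \<omega> 0 \<in> ball (c *\<^sub>R w) 1}"
  have "prob A > 0"
    unfolding A_def by (rule brownian_increment_ball_pos[OF bm]) (use e in auto)
  moreover have "prob (A \<inter> R (real n)) = prob A * prob (R (real n))"
    unfolding A_def R_def
    by (rule brownian_increment_indep_oscillation(2)[OF bm e]) auto
  ultimately have pos: "prob (A \<inter> R (real n)) > 0" using n by (simp add: zero_less_measure_iff)
  let ?F = "tube_functional e (c *\<^sub>R w) (c * \<rho>)"
  have Lip: "Lipschitz_continuous_map path_space euclidean_metric ?F"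
    by (rule Lipschitz_tube_functional) (use e c \<rho> in auto)
  have Fm: "?F \<in> borel_measurable P"
    using borel_measurable_borel_sigma[of "mtopology_of path_space" ?F]
      Lipschitz_continuous_imp_continuous_map[OF Lip]
    by (simp add: measurable_cong_sets[OF se refl])
  obtain K where K: "\<And>\<omega>. \<omega> \<in> mspace path_space \<Longrightarrow> norm (?F \<omega>) \<le> K"
    using bounded_tube_functional[of e "c * \<rho>" "c *\<^sub>R w"] e c \<rho> by (auto simp: bounded_iff)
  have Fi: "integrable P ?F"
    by (rule integrable_const_bound[of _ K]) (use K Fm sp in \<open>auto intro!: AE_I2\<close>)
  have Am: "A \<in> sets P"
  proof -
    have [measurable]: "(\<lambda>\<omega>. \<omega> e) \<in> borel_measurable P" "(\<lambda>\<omega>. \<omega> 0) \<in> borel_measurable P"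
      using bm e by (auto simp: standard_brownian_motion_def)
    have [measurable]: "ball (c *\<^sub>R w) 1 \<in> sets borel" by simp
    show ?thesis unfolding A_def by measurable
  qed
  \<comment> \<open>\<open>A\<close> controls the increment from 0 to \<open>e\<close>; starting at
    the origin almost surely turns this into control of the position at time
    \<open>e\<close>.\<close>
  have "AE \<omega> in P. \<omega> 0 = 0" using bm by (simp add: standard_brownian_motion_def)
  then have "AE \<omega> in P. (1 / 2) * indicator (A \<inter> R (real n)) \<omega> \<le> ?F \<omega>"
  proof eventually_elim
    case (elim \<omega>)
    show ?case
    proof (cases "\<omega> \<in> A \<inter> R (real n)")
      case True
      have "dist (\<omega> s) (c *\<^sub>R w) \<le> real n + 1" if "s \<in> {e..1}" for s
      proof -
        have "dist (\<omega> s) (\<omega> e) \<le> real n" "dist (\<omega> e) (c *\<^sub>R w) \<le> 1"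
          using True that elim by (auto simp: R_def A_def dist_commute)
        then show ?thesis using dist_triangle[of "\<omega> s" "c *\<^sub>R w" "\<omega> e"] by linarith
      qed
      then have "1 - (real n + 1) / (c * \<rho>) \<le> ?F \<omega>"
        by (intro tube_functional_ge) (use e c \<rho> in auto)
      moreover have "(real n + 1) / (c * \<rho>) = 1 / 2" unfolding c(2) by simp
      ultimately show ?thesis using True by simp
    qed (simp add: tube_functional_def)
  qed
  then have "(\<integral>\<omega>. (1 / 2) * indicator (A \<inter> R (real n)) \<omega> \<partial>P) \<le> (\<integral>\<omega>. ?F \<omega> \<partial>P)"
    using Fi Am Rm by (intro integral_mono_AE integrable_mult_right integrable_real_indicator)
      (auto simp: emeasure_eq_measure)
  then have "(\<integral>\<omega>. ?F \<omega> \<partial>P) > 0" using pos Am Rm by simp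
  with c(1) show ?thesis using that by force
qed

section \<open>Occupation times of cones\<close>

text \<open>As a function of \<open>s\<close>, the orbit enters only through an integer index, so
  measurability follows by composition through \<open>count_space\<close>.\<close>

lemma occupation_integrand_measurable:
  fixes \<Phi> :: "'x \<Rightarrow> 'v::euclidean_space"
  assumes "C \<in> sets borel"
  shows "(\<lambda>s. indicator C (interpolated_path T \<Phi> n x s) :: real) \<in> borel_measurable borel"
    and "set_integrable lborel {0..1} (\<lambda>s. indicator C (interpolated_path T \<Phi> n x s) :: real)"
proof -
  have [measurable]: "(\<lambda>s::real. nat \<lfloor>real n * s\<rfloor>) \<in> measurable borel (count_space UNIV)"
    by measurable
  have [measurable]: "(\<lambda>s::real. cocycle T \<Phi> (nat \<lfloor>real n * s\<rfloor>) x) \<in> borel_measurable borel"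
    by (rule measurable_compose[where N = "count_space UNIV"]) auto
  have [measurable]: "(\<lambda>s::real. \<Phi> ((T ^^ (nat \<lfloor>real n * s\<rfloor>)) x)) \<in> borel_measurable borel"
    by (rule measurable_compose[where N = "count_space UNIV" and g = "\<lambda>k. \<Phi> ((T ^^ k) x)"]) auto
  have "(\<lambda>s. interpolated_path T \<Phi> n x s) \<in> borel_measurable borel"
    unfolding interpolated_path_def Let_def by measurable
  then show 1: "(\<lambda>s. indicator C (interpolated_path T \<Phi> n x s) :: real) \<in> borel_measurable borel"
    using assms by measurable
  show "set_integrable lborel {0..1} (\<lambda>s. indicator C (interpolated_path T \<Phi> n x s) :: real)"
    unfolding set_integrable_def
    by (rule Bochner_Integration.integrable_bound[where f = "\<lambda>s. indicator {0..1} s :: real"])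
      (use 1 in \<open>auto simp: indicator_def[of C] intro!: integrable_real_indicator\<close>)
qed

lemma occupation_time_nonneg: "0 \<le> occupation_time T \<Phi> C n x"
  unfolding occupation_time_def set_lebesgue_integral_def by (rule Bochner_Integration.integral_nonneg) auto

text \<open>This turns the lower limit for \<open>C\<close> into an upper limit for the
  complement.\<close>

lemma occupation_time_Compl:
  fixes \<Phi> :: "'x \<Rightarrow> 'v::euclidean_space"
  assumes "C \<in> sets borel"
  shows "occupation_time T \<Phi> (- C) n x = 1 - occupation_time T \<Phi> C n x"
proof -
  have "occupation_time T \<Phi> (- C) n x =
      (LBINT s:{0..1}. 1 - indicator C (interpolated_path T \<Phi> n x s))"
    unfolding occupation_time_def by (simp add: indicator_compl)
  also have "\<dots> = (LBINT s:{0..1::real}. 1 :: real) - occupation_time T \<Phi> C n x"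
    unfolding occupation_time_def
    by (rule set_integral_diff(2)[OF _ occupation_integrand_measurable(2)[OF assms]])
      (simp add: set_integrable_def)
  finally show ?thesis by (simp add: set_lebesgue_integral_def)
qed

lemma occupation_time_le_1:
  fixes \<Phi> :: "'x \<Rightarrow> 'v::euclidean_space"
  assumes "C \<in> sets borel"
  shows "occupation_time T \<Phi> C n x \<le> 1"
  using occupation_time_nonneg[of T \<Phi> "- C" n x] occupation_time_Compl[OF assms, of T \<Phi> n x] by simp

lemma occupation_time_ge:
  fixes \<Phi> :: "'x \<Rightarrow> 'v::euclidean_space"
  assumes C: "C \<in> sets borel" and e: "0 \<le> e" "e \<le> 1"
    and in_C: "\<And>s. s \<in> {e..1} \<Longrightarrow> interpolated_path T \<Phi> n x s \<in> C"
  shows "1 - e \<le> occupation_time T \<Phi> C n x"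
proof -
  have "(\<integral>s. indicator {e..1} s \<partial>lborel) \<le> occupation_time T \<Phi> C n x"
    unfolding occupation_time_def set_lebesgue_integral_def
    using occupation_integrand_measurable(2)[OF C, of T \<Phi> n x, unfolded set_integrable_def]
  proof (intro integral_mono)
    show "indicator {e..1} s \<le>
        indicat_real {0..1} s *\<^sub>R indicat_real C (interpolated_path T \<Phi> n x s)" for s
      using in_C[of s] e by (auto simp: indicator_def)
  qed (use e in \<open>auto intro!: integrable_real_indicator\<close>)
  then show ?thesis using e by simp
qed

lemma frequently_occupation_time_ge:
  fixes M :: "'x measure" and \<Phi> :: "'x \<Rightarrow> real ^ 'd" and C :: "(real ^ 'd) set"
  assumes erg: "ergodic_system M T"
    and bdd: "bounded (\<Phi> ` space M)"
    and inv: "invariance_principle M T \<Phi>"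
    and cone: "positive_cone C" and C: "C \<in> sets borel" "interior C \<noteq> {}"
    and e: "0 < e" "e < 1"
  shows "AE x in M. \<exists>\<^sub>F n in sequentially. 1 - e \<le> occupation_time T \<Phi> C n x"
proof -
  define Y where "Y = (\<lambda>(n::nat) x. \<lambda>s\<in>{0..1}. interpolated_path T \<Phi> n x s /\<^sub>R sqrt (real n))"
  obtain P where W: "wiener_measure P" and conv: "converges_in_distribution M path_space Y P"
    using inv unfolding invariance_principle_def Y_def by blast
  have Ysp: "Y n x \<in> mspace path_space" if "x \<in> space M" for n x
  proof -
    have "Y n \<in> measurable M (borel_sigma (mtopology_of path_space))"
      using conv unfolding converges_in_distribution_def by (elim conjE allE)
    from measurable_space[OF this that] show ?thesis by (simp only: space_borel_sigma_mtopology)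
  qed
  have TM: "T x \<in> space M" if "x \<in> space M" for x
    using erg that by (auto simp: ergodic_system_def dest: measurable_space)
  obtain K where K: "\<And>x. x \<in> space M \<Longrightarrow> norm (\<Phi> x) \<le> K"
    using bdd by (auto simp: bounded_iff)
  obtain w \<rho> where \<rho>: "\<rho> > 0" "ball w \<rho> \<subseteq> C"
    using C(2) by (auto simp: mem_interior)
  obtain c where c: "c > 0" and pos: "(\<integral>\<omega>. tube_functional e (c *\<^sub>R w) (c * \<rho>) \<omega> \<partial>P) \<noteq> 0"
    using wiener_tube_functional_pos[OF W e \<rho>(1)] .
  have shift: "(\<lambda>n. mdist path_space (Y n (T x)) (Y n x)) \<longlonglongrightarrow> 0" if x: "x \<in> space M" for x
  proof (rule Lim_null_comparison)
    have "mdist path_space (Y n (T x)) (Y n x) \<le> 4 * K / sqrt (real n)" for n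
      unfolding path_space_def
    proof (rule mdist_cfunspace_le)
      show "0 \<le> 4 * K / sqrt (real n)" using order_trans[OF norm_ge_zero K[OF x]] by simp
      fix s :: real assume "s \<in> topspace (top_of_set {0..1})"
      then have s: "s \<in> {0..1}" by simp
      have "norm (interpolated_path T \<Phi> n (T x) s - interpolated_path T \<Phi> n x s) \<le> 4 * K"
        by (rule interpolated_path_shift[of "space M"]) (use TM K x s in auto)
      then have "norm ((interpolated_path T \<Phi> n (T x) s - interpolated_path T \<Phi> n x s)
          /\<^sub>R sqrt (real n)) \<le> 4 * K / sqrt (real n)"
        by (simp add: divide_inverse mult.commute mult_left_mono del: mult_le_cancel_left)
      then show "mdist euclidean_metric (Y n (T x) s) (Y n x s) \<le> 4 * K / sqrt (real n)"
        using s by (simp add: Y_def dist_norm scaleR_diff_right)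
    qed
    then show "\<forall>\<^sub>F n in sequentially.
        norm (mdist path_space (Y n (T x)) (Y n x)) \<le> 4 * K / sqrt (real n)" by simp
    show "(\<lambda>n. 4 * K / sqrt (real n)) \<longlonglongrightarrow> 0"
      by (intro tendsto_divide_0[OF tendsto_const] filterlim_at_top_imp_at_infinity
          filterlim_compose[OF sqrt_at_top filterlim_real_sequentially])
  qed
  have "AE x in M. \<not> (\<lambda>n. tube_functional e (c *\<^sub>R w) (c * \<rho>) (Y n x)) \<longlonglongrightarrow> 0"
    using e c \<rho> shift
    by (intro ergodic_not_tendsto_zero[OF erg conv _ _ _ pos] Lipschitz_tube_functional
        bounded_tube_functional) auto
  moreover have "AE x in M. x \<in> space M" by (rule AE_space)
  ultimately show ?thesis
  proof eventually_elim
    case (elim x)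
    have "\<exists>\<^sub>F n in sequentially. tube_functional e (c *\<^sub>R w) (c * \<rho>) (Y n x) > 0"
    proof (rule ccontr)
      assume "\<not> ?thesis"
      then have "\<forall>\<^sub>F n in sequentially. tube_functional e (c *\<^sub>R w) (c * \<rho>) (Y n x) = 0"
        unfolding not_frequently by (rule eventually_mono) (simp add: tube_functional_def)
      then have "(\<lambda>n. tube_functional e (c *\<^sub>R w) (c * \<rho>) (Y n x)) \<longlonglongrightarrow> 0"
        by (rule tendsto_eventually)
      then show False using elim(1) by contradiction
    qed
    \<comment> \<open>For \<open>n = 0\<close> the scaling factor \<open>inverse (sqrt 0)\<close> is
      0 and the path cannot be recovered from \<open>Y n x\<close>; this index is discarded.\<close>
    then have "\<exists>\<^sub>F n in sequentially. tube_functional e (c *\<^sub>R w) (c * \<rho>) (Y n x) > 0 \<and> n \<ge> 1"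
      using eventually_ge_at_top[of 1]
      by (rule frequently_eventually_conj[THEN frequently_elim1]) simp
    then show ?case
    proof (rule frequently_elim1)
      fix n assume n: "tube_functional e (c *\<^sub>R w) (c * \<rho>) (Y n x) > 0 \<and> n \<ge> 1"
      show "1 - e \<le> occupation_time T \<Phi> C n x"
      proof (rule occupation_time_ge[OF C(1)])
        fix s assume s: "s \<in> {e..1}"
        have "dist (Y n x s) (c *\<^sub>R w) < c * \<rho>"
          by (rule tube_functional_posD[OF Ysp[OF elim(2)] _ _ _ s]) (use n e c \<rho> in auto)
        moreover have "dist (Y n x s) (c *\<^sub>R w) = norm (c *\<^sub>R (Y n x s /\<^sub>R c - w))"
          using c by (simp add: dist_norm scaleR_diff_right)
        then have "dist (Y n x s) (c *\<^sub>R w) = c * dist (Y n x s /\<^sub>R c) w"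
          using c by (simp add: dist_norm)
        \<comment> \<open>Dividing by \<open>c\<close> moves the dilated ball back to the ball
          around \<open>w\<close> inside \<open>C\<close>; multiplying by \<open>sqrt n * c\<close>
          then stays in the cone and restores the unscaled path.\<close>
        ultimately have "Y n x s /\<^sub>R c \<in> C" using \<rho> c by (auto simp: dist_commute)
        moreover have "sqrt (real n) * c * (inverse c * inverse (sqrt (real n))) = 1"
          using n c by (simp add: field_simps)
        then have "interpolated_path T \<Phi> n x s = (sqrt (real n) * c) *\<^sub>R (Y n x s /\<^sub>R c)"
          using s e by (simp add: Y_def)
        moreover have "sqrt (real n) * c > 0" using n c by simp
        ultimately show "interpolated_path T \<Phi> n x s \<in> C"
          using cone unfolding positive_cone_def by metis
      qed (use e in auto)
    qed
  qed
qed

section \<open>Upper and lower limits\<close>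

text \<open>Countably many levels allow the exceptional null sets to be united. The shift by 2 keeps
  \<open>e = 1 / (k + 2)\<close> strictly between 0 and 1.\<close>

lemma Limsup_eq_1_if_frequently_ge:
  fixes f :: "nat \<Rightarrow> real"
  assumes "\<And>n. f n \<le> 1" and "\<And>k::nat. \<exists>\<^sub>F n in sequentially. 1 - 1 / real (k + 2) \<le> f n"
  shows "limsup (\<lambda>n. ereal (f n)) = 1"
proof (rule antisym)
  show "limsup (\<lambda>n. ereal (f n)) \<le> 1" by (rule Limsup_bounded) (simp add: assms one_ereal_def)
  have "ereal (1 - 1 / real (k + 2)) \<le> limsup (\<lambda>n. ereal (f n))" for k
  proof (rule ccontr)
    assume "\<not> ?thesis"
    then have "\<forall>\<^sub>F n in sequentially. ereal (f n) < ereal (1 - 1 / real (k + 2))"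
      by (intro Limsup_lessD) simp
    then show False
      using assms(2)[of k] by (simp add: frequently_def not_le)
  qed
  moreover have "(\<lambda>k. ereal (1 - 1 / real (k + 2))) \<longlonglongrightarrow> ereal (1 - 0)"
    unfolding lim_ereal
    by (intro tendsto_diff tendsto_const LIMSEQ_ignore_initial_segment[OF lim_1_over_n])
  ultimately show "1 \<le> limsup (\<lambda>n. ereal (f n))"
    by (intro LIMSEQ_le_const2[where X = "\<lambda>k. ereal (1 - 1 / real (k + 2))"])
      (auto simp: one_ereal_def)
qed

theorem theorem3p4:
  fixes M :: "'x measure" and T :: "'x \<Rightarrow> 'x"
    and \<Phi> :: "'x \<Rightarrow> real ^ 'd" and C :: "(real ^ 'd) set"
  assumes "CARD('d) \<ge> 2"
    and "ergodic_system M T"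
    and "\<Phi> \<in> borel_measurable M"
    and "bounded (\<Phi> ` space M)"
    and "integral\<^sup>L M \<Phi> = 0"
    and "invariance_principle M T \<Phi>"
    and "positive_cone C"
    and "C \<in> sets borel"
    and "interior C \<noteq> {}"
    and "interior (- C) \<noteq> {}"
  shows "AE x in M.
    limsup (\<lambda>n. ereal (occupation_time T \<Phi> C n x)) = 1 \<and>
    liminf (\<lambda>n. ereal (occupation_time T \<Phi> C n x)) = 0"
proof -
  \<comment> \<open>Stated for any cone \<open>D\<close>, to serve both \<open>C\<close> and its
    complement.\<close>
  have limsup: "AE x in M. limsup (\<lambda>n. ereal (occupation_time T \<Phi> D n x)) = 1"
    if D: "positive_cone D" "D \<in> sets borel" "interior D \<noteq> {}" for D
  proof -
    have "AE x in M. \<forall>k::nat. \<exists>\<^sub>F n in sequentially.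
        1 - 1 / real (k + 2) \<le> occupation_time T \<Phi> D n x"
      unfolding AE_all_countable
      by (intro allI frequently_occupation_time_ge assms D) auto
    then show ?thesis
      by eventually_elim (intro Limsup_eq_1_if_frequently_ge occupation_time_le_1 D(2), blast)
  qed
  \<comment> \<open>Positive scalars are invertible, so a dilation cannot lead from outside
    \<open>C\<close> into \<open>C\<close>.\<close>
  have "positive_cone (- C)"
    unfolding positive_cone_def
  proof (intro ballI allI impI ComplI)
    fix v and c :: real assume v: "v \<in> - C" "c > 0" "c *\<^sub>R v \<in> C"
    then have "inverse c *\<^sub>R c *\<^sub>R v \<in> C"
      using assms(7) by (metis positive_cone_def positive_imp_inverse_positive)
    then show False using v by simp
  qed
  moreover have "- C \<in> sets borel" using assms(8) by (simp add: borel_comp)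
  ultimately have "AE x in M. limsup (\<lambda>n. ereal (occupation_time T \<Phi> (- C) n x)) = 1"
    using assms(10) by (rule limsup)
  moreover have "AE x in M. limsup (\<lambda>n. ereal (occupation_time T \<Phi> C n x)) = 1"
    using assms(7-9) by (rule limsup)
  ultimately show ?thesis
  proof eventually_elim
    case (elim x)
    have "ereal (occupation_time T \<Phi> C n x) = 1 - ereal (occupation_time T \<Phi> (- C) n x)" for n
      using occupation_time_Compl[OF assms(8), of T \<Phi> n x] by (simp add: one_ereal_def)
    then have "liminf (\<lambda>n. ereal (occupation_time T \<Phi> C n x)) = 0"
      using liminf_ereal_cminus[of 1 "\<lambda>n. ereal (occupation_time T \<Phi> (- C) n x)"] elim(1)
      by (simp add: one_ereal_def)
    with elim(2) show ?case by blast
  qed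
qed

end
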